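(* Let $X$ be a non-negative random variable with $a:=\mathbb{E}X\in(0,\infty)$, and let $c\in(0,\infty)$. Assume that $X$ admits a $c$-bounded size bias coupling. Then for every $x\ge a$, $$\mathbb{P}(X\ge x)\ \le\ \left(\frac{a}{x}\right)^{x/c}e^{(x-a)/c},$$ and for every $x$ with $0\le x\le a$, $$\mathbb{P}(X\le x)\ \le\ \left(\frac{a}{x}\right)^{x/c}e^{(x-a)/c},$$ where $(a/x)^{x/c}$ is interpreted as $1$ when $x=0$.
   Context: For a non-negative random variable $X$ with $0<\mathbb{E}X<\infty$, a random variable $Y$ is said to have the size biased distribution of $X$, written $Y=^d X^*$, if $\mathbb{P}(Y\in dx)/\mathbb{P}(X\in dx)=x/\mathbb{E}X$ (Radon–Nikodym derivative), i.e. $\mathbb{E}\,g(Y)=\mathbb{E}(Xg(X))/\mathbb{E}X$ for all bounded measurable $g$. A coupling of $X$ and $Y$ is a realization of random variables with the distributions of $X$ and $Y$ on a common probability space. We say that $X$ admits a $c$-bounded size bias coupling if there is a coupling of $X$ with $Y=^dX^*$ in which $Y\le X+c$ almost surely. *)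

theory Defs
  imports "HOL-Probability.Probability"
begin

text \<open>
  The law of \<open>X\<^sup>*\<close> for \<open>X\<close> with law \<open>\<mu>\<close>: Radon-Nikodym derivative \<open>x / E X\<close> with respect to \<open>\<mu>\<close>.
  It is meaningful only if \<open>\<mu>\<close> lives on \<open>[0, \<infinity>)\<close> and has a mean in \<open>(0, \<infinity>)\<close>: the Bochner
  integral is \<open>0\<close> for a law without a mean, and \<open>ennreal\<close> sends negative numbers to \<open>0\<close>.
\<close>

definition size_bias_law :: "real measure \<Rightarrow> real measure" where
  "size_bias_law \<mu> = density \<mu> (\<lambda>x. ennreal (x / (\<integral>y. y \<partial>\<mu>)))"

definition is_coupling ::
  "'b measure \<Rightarrow> ('b \<Rightarrow> real) \<Rightarrow> ('b \<Rightarrow> real) \<Rightarrow> real measure \<Rightarrow> real measure \<Rightarrow> bool" where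
  "is_coupling N U V \<mu> \<nu> \<longleftrightarrow>
     prob_space N \<and> U \<in> borel_measurable N \<and> V \<in> borel_measurable N \<and>
     distr N borel U = \<mu> \<and> distr N borel V = \<nu>"

text \<open>
  The coupling lives on its own probability space \<open>N\<close>, unrelated to the space \<open>M\<close> of \<open>X\<close>;
  \<open>U\<close> is the copy of \<open>X\<close> and \<open>V\<close> the copy of \<open>X\<^sup>*\<close>. That \<open>X\<close> admits such a coupling is the
  existence of \<open>N\<close>, \<open>U\<close>, \<open>V\<close>. A definition cannot quantify over the type of points of \<open>N\<close>, so
  this existence is stated where it is used, with that type left as a type variable.
\<close>

definition bounded_size_bias_coupling ::
  "real \<Rightarrow> 'a measure \<Rightarrow> ('a \<Rightarrow> real) \<Rightarrow> 'b measure \<Rightarrow> ('b \<Rightarrow> real) \<Rightarrow> ('b \<Rightarrow> real) \<Rightarrow> bool" where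
  "bounded_size_bias_coupling c M X N U V \<longleftrightarrow>
     is_coupling N U V (distr M borel X) (size_bias_law (distr M borel X)) \<and>
     (AE \<omega> in N. V \<omega> \<le> U \<omega> + c)"

end

theory Submission
  imports Defs
begin

text \<open>
  The idea is to bound the moment generating function by a differential inequality and then to
  apply the exponential Markov inequality. Write \<open>\<phi> b = E (exp (b X))\<close>. Size biasing turns the
  derivative of \<open>\<phi>\<close> into an expectation over \<open>X\<^sup>*\<close>, and the coupling \<open>X\<^sup>* \<le> X + c\<close> bounds it by
  \<open>\<phi>\<close> itself: for \<open>b \<ge> 0\<close>,
  \<open>\<phi>' b = E (X exp (b X)) = a E (exp (b X\<^sup>*)) \<le> a exp (b c) \<phi> b\<close>,
  and for \<open>b \<le> 0\<close> the inequality is reversed. As \<open>a exp (b c)\<close> is the derivative of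
  \<open>K b = a (exp (b c) - 1) / c\<close>, integrating from \<open>0\<close>, where \<open>\<phi> = 1\<close> and \<open>K = 0\<close>, gives
  \<open>\<phi> b \<le> exp (K b)\<close> for both signs of \<open>b\<close> (that is, \<open>\<phi>\<close> is dominated by the transform of \<open>c\<close>
  times a Poisson variable of mean \<open>a / c\<close>). Markov's inequality then bounds each tail at \<open>x\<close> by
  \<open>exp (K b - b x)\<close>; the minimiser is \<open>b = ln (x / a) / c\<close>, whose sign is right for the upper tail
  when \<open>x \<ge> a\<close> and for the lower tail when \<open>x \<le> a\<close>. For \<open>x = 0\<close> the minimiser is \<open>-\<infinity>\<close>, and the
  bound is reached as a limit.

  For \<open>b > 0\<close> it is not clear beforehand that \<open>\<phi> b\<close> is finite. The argument survives
  if \<open>X\<close> is replaced by \<open>min X k\<close>, since \<open>y \<mapsto> exp (b min y k)\<close> is still increasing and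
  \<open>min (X + c) k \<le> min X k + c\<close>; and the choice \<open>k = x\<close> does not change the event \<open>X \<ge> x\<close>, so no
  limit in \<open>k\<close> has to be taken.
\<close>

section \<open>A differential inequality\<close>

text \<open>
  The integrating factor \<open>exp (- K)\<close> makes the product \<open>f exp (- K)\<close> nonincreasing. The
  reversed inequality is covered by passing to \<open>- f\<close>, as \<open>f\<close> may have any sign.
\<close>

lemma gronwall_exp:
  fixes f f' K K' :: "real \<Rightarrow> real"
  assumes "s \<le> t"
    and f: "\<And>u. u \<in> {s..t} \<Longrightarrow> (f has_real_derivative f' u) (at u within {s..t})"
    and K: "\<And>u. u \<in> {s..t} \<Longrightarrow> (K has_real_derivative K' u) (at u within {s..t})"
    and le: "\<And>u. u \<in> {s..t} \<Longrightarrow> f' u \<le> K' u * f u"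
  shows "f t * exp (- K t) \<le> f s * exp (- K s)"
proof -
  define h where "h u = (f' u - K' u * f u) * exp (- K u)" for u
  have "((\<lambda>u. f u * exp (- K u)) has_real_derivative h u) (at u within {s..t})"
    if "u \<in> {s..t}" for u
    unfolding h_def by (rule derivative_eq_intros f K that refl)+ (simp add: algebra_simps)
  then obtain u where u: "u \<in> {s..t}"
    "f t * exp (- K t) - f s * exp (- K s) = h u * (t - s)"
    using mvt_very_simple[OF \<open>s \<le> t\<close>, of "\<lambda>u. f u * exp (- K u)" "\<lambda>u. (*) (h u)"]
    by (auto simp: has_field_derivative_def)
  have "h u * (t - s) \<le> 0"
    using le[OF u(1)] \<open>s \<le> t\<close> unfolding h_def
    by (intro mult_nonpos_nonneg) auto
  with u(2) show ?thesis by simp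
qed

section \<open>Differentiating the moment generating function\<close>

lemma exp_difference_quotient_bound:
  fixes r s b y :: real
  assumes "r \<le> b" "s \<le> b" "r \<noteq> s" "0 \<le> y"
  shows "\<bar>(exp (r * y) - exp (s * y)) / (r - s)\<bar> \<le> y * exp (b * y)"
proof -
  have *: "exp (t * y) - exp (u * y) \<le> (t - u) * (y * exp (b * y))" "0 \<le> exp (t * y) - exp (u * y)"
    if "u \<le> t" "t \<le> b" for t u
  proof -
    have "exp (t * y) - exp (u * y) = exp (t * y) * (1 - exp ((u - t) * y))"
      by (simp add: algebra_simps flip: exp_add)
    also have "\<dots> \<le> exp (t * y) * ((t - u) * y)"
      using exp_ge_add_one_self[of "(u - t) * y"] by (intro mult_left_mono) (auto simp: algebra_simps)
    also have "\<dots> \<le> exp (b * y) * ((t - u) * y)"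
      using that assms by (intro mult_right_mono) (auto intro: mult_right_mono)
    finally show "exp (t * y) - exp (u * y) \<le> (t - u) * (y * exp (b * y))"
      by (simp add: algebra_simps)
    show "0 \<le> exp (t * y) - exp (u * y)"
      using that assms by (auto intro: mult_right_mono)
  qed
  show ?thesis
    using *[of r s] *[of s r] assms
    by (cases "r < s") (auto simp: abs_divide divide_le_eq mult.commute)
qed

text \<open>
  The difference quotients of \<open>exp (s T)\<close> to the left of \<open>b\<close> are dominated by \<open>T exp (b T)\<close>, so
  the derivative may be taken inside the expectation. The derivative is taken within \<open>{..b}\<close> so
  as to include \<open>s = b\<close>, where nothing may be known to the right of \<open>b\<close>.
\<close>

lemma mgf_has_real_derivative:
  fixes T :: "'b \<Rightarrow> real"
  assumes T[measurable]: "T \<in> borel_measurable N"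
    and nn: "AE w in N. 0 \<le> T w"
    and int0: "integrable N (\<lambda>w. exp (b * T w))"
    and int1: "integrable N (\<lambda>w. T w * exp (b * T w))"
    and "s \<le> b"
  shows "((\<lambda>u. \<integral>w. exp (u * T w) \<partial>N) has_real_derivative (\<integral>w. T w * exp (s * T w) \<partial>N))
           (at s within {..b})"
  unfolding has_field_derivative_iff tendsto_at_iff_sequentially comp_def
proof (intro allI impI)
  fix r :: "nat \<Rightarrow> real"
  assume r: "\<forall>i. r i \<in> {..b} - {s}" and lim: "r \<longlonglongrightarrow> s"
  have int: "integrable N (\<lambda>w. exp (u * T w))" if "u \<le> b" for u
    by (rule Bochner_Integration.integrable_bound[OF int0])
      (use nn that in \<open>auto elim!: eventually_mono intro: mult_right_mono\<close>)
  have quot: "((\<integral>w. exp (r i * T w) \<partial>N) - (\<integral>w. exp (s * T w) \<partial>N)) / (r i - s)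
      = (\<integral>w. (exp (r i * T w) - exp (s * T w)) / (r i - s) \<partial>N)" for i
    using r int \<open>s \<le> b\<close> by (simp add: Bochner_Integration.integral_diff)
  show "(\<lambda>i. ((\<integral>w. exp (r i * T w) \<partial>N) - (\<integral>w. exp (s * T w) \<partial>N)) / (r i - s))
      \<longlonglongrightarrow> (\<integral>w. T w * exp (s * T w) \<partial>N)"
    unfolding quot
  proof (rule integral_dominated_convergence[OF _ _ int1])
    show "AE w in N. (\<lambda>i. (exp (r i * T w) - exp (s * T w)) / (r i - s))
        \<longlonglongrightarrow> T w * exp (s * T w)"
    proof (rule AE_I2)
      fix w
      have "((\<lambda>u. exp (u * T w)) has_real_derivative T w * exp (s * T w)) (at s)"
        by (auto intro!: derivative_eq_intros)
      then have "((\<lambda>u. (exp (u * T w) - exp (s * T w)) / (u - s)) \<longlongrightarrow> T w * exp (s * T w)) (at s)"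
        by (simp add: has_field_derivative_iff)
      then show "(\<lambda>i. (exp (r i * T w) - exp (s * T w)) / (r i - s)) \<longlonglongrightarrow> T w * exp (s * T w)"
        using r lim unfolding tendsto_at_iff_sequentially comp_def by auto
    qed
    show "AE w in N. norm ((exp (r i * T w) - exp (s * T w)) / (r i - s)) \<le> T w * exp (b * T w)"
      for i
      using nn
    proof eventually_elim
      case (elim w)
      then show ?case
        using exp_difference_quotient_bound[of "r i" b s "T w"] r \<open>s \<le> b\<close> by auto
    qed
  qed auto
qed

section \<open>Moment generating functions under a bounded size bias coupling\<close>

lemma size_bias_coupling_expectation:
  fixes g :: "real \<Rightarrow> real"
  assumes cpl: "is_coupling N U V \<mu> (size_bias_law \<mu>)"
    and nn: "AE w in N. 0 \<le> U w"
    and a: "a = (\<integral>w. U w \<partial>N)" "0 < a"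
    and g[measurable]: "g \<in> borel_measurable borel"
  shows "(\<integral>w. U w * g (U w) \<partial>N) = a * (\<integral>w. g (V w) \<partial>N)"
proof -
  have [measurable]: "U \<in> borel_measurable N" "V \<in> borel_measurable N"
    and \<mu>: "\<mu> = distr N borel U" and \<nu>: "distr N borel V = size_bias_law \<mu>"
    using cpl by (auto simp: is_coupling_def)
  have mean: "(\<integral>y. y \<partial>\<mu>) = a"
    unfolding \<mu> a by (simp add: integral_distr)
  have "AE y in \<mu>. 0 \<le> y"
    unfolding \<mu> using nn by (simp add: AE_distr_iff)
  then have nn': "AE y in \<mu>. 0 \<le> y / a"
    using \<open>0 < a\<close> by (auto elim: eventually_mono)
  have sets[measurable_cong]: "sets \<mu> = sets borel" unfolding \<mu> by simp
  have "(\<integral>w. g (V w) \<partial>N) = (\<integral>y. g y \<partial>size_bias_law \<mu>)"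
    by (simp add: integral_distr flip: \<nu>)
  also have "\<dots> = (\<integral>y. (y / a) *\<^sub>R g y \<partial>\<mu>)"
    unfolding size_bias_law_def mean by (rule integral_density) (use nn' in auto)
  also have "\<dots> = (\<integral>w. U w / a * g (U w) \<partial>N)"
    unfolding \<mu> by (simp add: integral_distr)
  also have "\<dots> = (\<integral>w. U w * g (U w) \<partial>N) / a"
    by simp
  finally show ?thesis using \<open>0 < a\<close> by simp
qed

text \<open>
  For \<open>b \<ge> 0\<close> the coupling bounds an increasing function of \<open>V\<close> from above. Truncation only
  decreases the factor \<open>U\<close> that performs the size biasing, which is the favourable direction.
\<close>

lemma size_bias_truncated_exp_upper:
  assumes cpl: "is_coupling N U V \<mu> (size_bias_law \<mu>)"
    and nn: "AE w in N. 0 \<le> U w"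
    and int: "integrable N U"
    and a: "a = (\<integral>w. U w \<partial>N)" "0 < a"
    and bd: "AE w in N. V w \<le> U w + c"
    and "0 < c" "0 \<le> b"
  shows "(\<integral>w. min (U w) k * exp (b * min (U w) k) \<partial>N)
           \<le> a * exp (b * c) * (\<integral>w. exp (b * min (U w) k) \<partial>N)"
proof -
  interpret prob_space N using cpl by (simp add: is_coupling_def)
  have [measurable]: "U \<in> borel_measurable N" "V \<in> borel_measurable N"
    using cpl by (auto simp: is_coupling_def)
  let ?g = "\<lambda>y. exp (b * min y k)"
  have g_le: "?g y \<le> exp (b * k)" for y
    using \<open>0 \<le> b\<close> by (auto intro: mult_left_mono)
  have intU: "integrable N (\<lambda>w. U w * ?g (U w))"
  proof (rule Bochner_Integration.integrable_bound)
    show "integrable N (\<lambda>w. exp (b * k) * U w)" using int by simp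
    show "AE w in N. norm (U w * ?g (U w)) \<le> norm (exp (b * k) * U w)"
      using g_le by (intro AE_I2) (simp add: abs_mult mult.commute mult_left_mono)
  qed simp
  have intg: "integrable N (\<lambda>w. ?g (W w))" if [measurable]: "W \<in> borel_measurable N" for W
    by (rule integrable_const_bound[where B = "exp (b * k)"]) (use g_le in auto)
  have "(\<integral>w. min (U w) k * ?g (U w) \<partial>N) \<le> (\<integral>w. U w * ?g (U w) \<partial>N)"
    using nn by (intro integral_mono_AE') (use intU in \<open>auto elim!: eventually_mono\<close>)
  also have "\<dots> = a * (\<integral>w. ?g (V w) \<partial>N)"
    by (rule size_bias_coupling_expectation[OF cpl nn a]) simp
  also have "(\<integral>w. ?g (V w) \<partial>N) \<le> (\<integral>w. exp (b * c) * ?g (U w) \<partial>N)"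
  proof (rule integral_mono_AE)
    show "AE w in N. ?g (V w) \<le> exp (b * c) * ?g (U w)"
      using bd
    proof eventually_elim
      case (elim w)
      then have "b * min (V w) k \<le> b * (c + min (U w) k)"
        using \<open>0 \<le> b\<close> \<open>0 < c\<close> by (intro mult_left_mono) auto
      then show ?case by (simp add: distrib_left flip: exp_add)
    qed
  qed (use intg in auto)
  finally show ?thesis using \<open>0 < a\<close> by (simp add: mult.assoc)
qed

text \<open>
  For \<open>b \<le> 0\<close> the function \<open>y \<mapsto> exp (b y)\<close> is decreasing, so \<open>V \<le> U + c\<close> gives a lower bound.
  Truncating the factor \<open>U\<close> would now be unfavourable; all integrals are finite
  without it, since \<open>exp (b U) \<le> 1\<close>.
\<close>

lemma size_bias_exp_lower:
  assumes cpl: "is_coupling N U V \<mu> (size_bias_law \<mu>)"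
    and nn: "AE w in N. 0 \<le> U w"
    and a: "a = (\<integral>w. U w \<partial>N)" "0 < a"
    and bd: "AE w in N. V w \<le> U w + c"
    and "0 < c" "b \<le> 0"
  shows "a * exp (b * c) * (\<integral>w. exp (b * U w) \<partial>N) \<le> (\<integral>w. U w * exp (b * U w) \<partial>N)"
proof -
  interpret prob_space N using cpl by (simp add: is_coupling_def)
  have [measurable]: "U \<in> borel_measurable N" "V \<in> borel_measurable N"
    using cpl by (auto simp: is_coupling_def)
  \<comment> \<open>The positive part keeps the test function bounded on the whole real line.\<close>
  let ?g = "\<lambda>y. exp (b * max 0 y)"
  have g_le: "?g y \<le> 1" for y
    using \<open>b \<le> 0\<close> by (auto simp: mult_nonpos_nonneg)
  have intg: "integrable N (\<lambda>w. ?g (W w))" if [measurable]: "W \<in> borel_measurable N" for W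
    by (rule integrable_const_bound[where B = 1]) (use g_le in auto)
  have gU: "AE w in N. ?g (U w) = exp (b * U w)"
    using nn by eventually_elim (simp add: max_absorb2)
  have "exp (b * c) * (\<integral>w. exp (b * U w) \<partial>N) = (\<integral>w. exp (b * c) * ?g (U w) \<partial>N)"
    using gU by (auto intro!: integral_cong_AE elim: eventually_mono)
  also have "\<dots> \<le> (\<integral>w. ?g (V w) \<partial>N)"
  proof (rule integral_mono_AE)
    show "AE w in N. exp (b * c) * ?g (U w) \<le> ?g (V w)"
      using bd nn
    proof eventually_elim
      case (elim w)
      then have "b * (c + max 0 (U w)) \<le> b * max 0 (V w)"
        using \<open>b \<le> 0\<close> \<open>0 < c\<close> by (intro mult_left_mono_neg) auto
      then show ?case by (simp add: distrib_left flip: exp_add)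
    qed
  qed (use intg in auto)
  finally have "a * exp (b * c) * (\<integral>w. exp (b * U w) \<partial>N) \<le> a * (\<integral>w. ?g (V w) \<partial>N)"
    using \<open>0 < a\<close> by (simp add: mult.assoc)
  also have "\<dots> = (\<integral>w. U w * ?g (U w) \<partial>N)"
    by (rule size_bias_coupling_expectation[OF cpl nn a, symmetric]) simp
  also have "\<dots> = (\<integral>w. U w * exp (b * U w) \<partial>N)"
    using gU by (auto intro!: integral_cong_AE elim: eventually_mono)
  finally show ?thesis .
qed

text \<open>
  The function differentiated here is the logarithm of the moment generating function of \<open>c\<close>
  times a Poisson variable of mean \<open>a / c\<close>.
\<close>

lemma poisson_log_mgf_has_real_derivative:
  fixes a c :: real
  assumes "0 < c"
  shows "((\<lambda>u. a * (exp (u * c) - 1) / c) has_real_derivative a * exp (u * c)) (at u within S)"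
  using assms by (auto intro!: derivative_eq_intros)

text \<open>
  At \<open>b = 0\<close> both sides equal \<open>1\<close>, so the differential inequality on \<open>{0..b}\<close> suffices; the
  truncation makes every integral finite beforehand.
\<close>

lemma size_bias_truncated_mgf_le:
  assumes cpl: "is_coupling N U V \<mu> (size_bias_law \<mu>)"
    and nn: "AE w in N. 0 \<le> U w"
    and int: "integrable N U"
    and a: "a = (\<integral>w. U w \<partial>N)" "0 < a"
    and bd: "AE w in N. V w \<le> U w + c"
    and "0 < c" "0 \<le> b" "0 \<le> k"
  shows "(\<integral>w. exp (b * min (U w) k) \<partial>N) \<le> exp (a * (exp (b * c) - 1) / c)"
proof -
  interpret prob_space N using cpl by (simp add: is_coupling_def)
  have [measurable]: "U \<in> borel_measurable N"
    using cpl by (auto simp: is_coupling_def)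
  let ?T = "\<lambda>w. min (U w) k"
  have T: "AE w in N. 0 \<le> ?T w"
    using nn \<open>0 \<le> k\<close> by (auto elim: eventually_mono)
  have e: "exp (b * ?T w) \<le> exp (b * k)" for w
    using \<open>0 \<le> b\<close> by (auto intro: mult_left_mono)
  have int0: "integrable N (\<lambda>w. exp (b * ?T w))"
    by (rule integrable_const_bound[where B = "exp (b * k)"]) (use e in auto)
  have int1: "integrable N (\<lambda>w. ?T w * exp (b * ?T w))"
  proof (rule integrable_const_bound[where B = "k * exp (b * k)"])
    show "AE w in N. norm (?T w * exp (b * ?T w)) \<le> k * exp (b * k)"
      using T
    proof eventually_elim
      case (elim w)
      have "?T w * exp (b * ?T w) \<le> k * exp (b * k)"
        by (rule mult_mono[OF _ e]) (use \<open>0 \<le> k\<close> in auto)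
      then show ?case using elim by (simp only: real_norm_def abs_mult abs_exp_cancel abs_of_nonneg)
    qed
  qed simp
  let ?f = "\<lambda>u. \<integral>w. exp (u * ?T w) \<partial>N" and ?K = "\<lambda>u. a * (exp (u * c) - 1) / c"
  have "?f b * exp (- ?K b) \<le> ?f 0 * exp (- ?K 0)"
  proof (rule gronwall_exp[OF \<open>0 \<le> b\<close>])
    fix u assume u: "u \<in> {0..b}"
    show "(?f has_real_derivative (\<integral>w. ?T w * exp (u * ?T w) \<partial>N)) (at u within {0..b})"
      by (rule has_field_derivative_subset[OF mgf_has_real_derivative[OF _ T int0 int1]])
        (use u in auto)
    show "(?K has_real_derivative a * exp (u * c)) (at u within {0..b})"
      by (rule poisson_log_mgf_has_real_derivative[OF \<open>0 < c\<close>])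
    show "(\<integral>w. ?T w * exp (u * ?T w) \<partial>N) \<le> a * exp (u * c) * ?f u"
      by (rule size_bias_truncated_exp_upper[OF cpl nn int a bd \<open>0 < c\<close>]) (use u in auto)
  qed
  then show ?thesis
    by (simp add: prob_space exp_minus field_simps)
qed

text \<open>
  To the left of \<open>0\<close> the reversed differential inequality is integrated backwards from \<open>0\<close>, which
  again yields an upper bound. Differentiability up to the endpoint \<open>0\<close> is the existence of the
  mean of \<open>U\<close>.
\<close>

lemma size_bias_mgf_le:
  assumes cpl: "is_coupling N U V \<mu> (size_bias_law \<mu>)"
    and nn: "AE w in N. 0 \<le> U w"
    and int: "integrable N U"
    and a: "a = (\<integral>w. U w \<partial>N)" "0 < a"
    and bd: "AE w in N. V w \<le> U w + c"
    and "0 < c" "b \<le> 0"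
  shows "(\<integral>w. exp (b * U w) \<partial>N) \<le> exp (a * (exp (b * c) - 1) / c)"
proof -
  interpret prob_space N using cpl by (simp add: is_coupling_def)
  have [measurable]: "U \<in> borel_measurable N"
    using cpl by (auto simp: is_coupling_def)
  let ?f = "\<lambda>u. \<integral>w. exp (u * U w) \<partial>N" and ?K = "\<lambda>u. a * (exp (u * c) - 1) / c"
  have "- ?f 0 * exp (- ?K 0) \<le> - ?f b * exp (- ?K b)"
  proof (rule gronwall_exp[OF \<open>b \<le> 0\<close>, where f = "\<lambda>u. - ?f u"])
    fix u assume u: "u \<in> {b..0}"
    have "(?f has_real_derivative (\<integral>w. U w * exp (u * U w) \<partial>N)) (at u within {..0})"
      by (rule mgf_has_real_derivative[OF _ nn]) (use int u in auto)
    then have "(?f has_real_derivative (\<integral>w. U w * exp (u * U w) \<partial>N)) (at u within {b..0})"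
      by (rule has_field_derivative_subset) auto
    then show "((\<lambda>u. - ?f u) has_real_derivative - (\<integral>w. U w * exp (u * U w) \<partial>N))
        (at u within {b..0})"
      by (rule DERIV_minus)
    show "(?K has_real_derivative a * exp (u * c)) (at u within {b..0})"
      by (rule poisson_log_mgf_has_real_derivative[OF \<open>0 < c\<close>])
    show "- (\<integral>w. U w * exp (u * U w) \<partial>N) \<le> a * exp (u * c) * - ?f u"
      using size_bias_exp_lower[OF cpl nn a bd \<open>0 < c\<close>, of u] u by simp
  qed
  then show ?thesis
    by (simp add: prob_space exp_minus field_simps)
qed

section \<open>Tail bounds\<close>

text \<open>
  The Chernoff exponent at its minimiser \<open>b = ln (x / a) / c\<close>, for which \<open>exp (b c) = x / a\<close>.
\<close>

lemma poisson_chernoff_exponent: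
  fixes a c x :: real
  assumes "0 < a" "0 < c" "0 < x" and b: "b = ln (x / a) / c"
  shows "exp (- b * x) * exp (a * (exp (b * c) - 1) / c)
           = (a / x) powr (x / c) * exp ((x - a) / c)"
proof -
  have "exp (b * c) = x / a"
    using assms by simp
  then have "a * (exp (b * c) - 1) / c = (x - a) / c"
    using assms by (simp add: field_simps)
  moreover have "- b * x = x / c * ln (a / x)"
    unfolding b using assms by (simp add: ln_div field_simps)
  ultimately show ?thesis
    using assms by (simp add: powr_def)
qed

lemma size_bias_upper_tail:
  assumes cpl: "is_coupling N U V \<mu> (size_bias_law \<mu>)"
    and nn: "AE w in N. 0 \<le> U w"
    and int: "integrable N U"
    and a: "a = (\<integral>w. U w \<partial>N)" "0 < a"
    and bd: "AE w in N. V w \<le> U w + c"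
    and "0 < c" "a \<le> x"
  shows "measure N {w \<in> space N. x \<le> U w} \<le> (a / x) powr (x / c) * exp ((x - a) / c)"
proof -
  interpret prob_space N using cpl by (simp add: is_coupling_def)
  have [measurable]: "U \<in> borel_measurable N"
    using cpl by (auto simp: is_coupling_def)
  define b where "b = ln (x / a) / c"
  have "0 < x" using a \<open>a \<le> x\<close> by linarith
  have "0 \<le> b" unfolding b_def using a \<open>a \<le> x\<close> \<open>0 < c\<close> by simp
  let ?T = "\<lambda>w. min (U w) x"
  have int0: "integrable N (\<lambda>w. exp (b * ?T w))"
    by (rule integrable_const_bound[where B = "exp (b * x)"])
      (use \<open>0 \<le> b\<close> in \<open>auto intro!: AE_I2 mult_left_mono\<close>)
  \<comment> \<open>Truncating at \<open>x\<close> itself leaves the event unchanged.\<close>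
  have "measure N {w \<in> space N. x \<le> U w} \<le> measure N {w \<in> space N. exp (b * x) \<le> exp (b * ?T w)}"
    by (rule finite_measure_mono) auto
  also have "\<dots> \<le> (\<integral>w. exp (b * ?T w) \<partial>N) / exp (b * x)"
    by (rule integral_Markov_inequality_measure[OF int0, where A = "{}"]) auto
  also have "\<dots> \<le> exp (a * (exp (b * c) - 1) / c) / exp (b * x)"
    using size_bias_truncated_mgf_le[OF cpl nn int a bd \<open>0 < c\<close> \<open>0 \<le> b\<close>, of x] \<open>0 < x\<close>
    by (intro divide_right_mono) auto
  also have "\<dots> = (a / x) powr (x / c) * exp ((x - a) / c)"
    using poisson_chernoff_exponent[OF \<open>0 < a\<close> \<open>0 < c\<close> \<open>0 < x\<close> b_def]
    by (simp add: exp_minus field_simps)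
  finally show ?thesis .
qed

lemma size_bias_lower_chernoff:
  assumes cpl: "is_coupling N U V \<mu> (size_bias_law \<mu>)"
    and nn: "AE w in N. 0 \<le> U w"
    and int: "integrable N U"
    and a: "a = (\<integral>w. U w \<partial>N)" "0 < a"
    and bd: "AE w in N. V w \<le> U w + c"
    and "0 < c" "b \<le> 0"
  shows "measure N {w \<in> space N. U w \<le> x} \<le> exp (- b * x) * exp (a * (exp (b * c) - 1) / c)"
proof -
  interpret prob_space N using cpl by (simp add: is_coupling_def)
  have [measurable]: "U \<in> borel_measurable N"
    using cpl by (auto simp: is_coupling_def)
  have int0: "integrable N (\<lambda>w. exp (b * U w))"
    by (rule integrable_const_bound[where B = 1])
      (use nn \<open>b \<le> 0\<close> in \<open>auto elim!: eventually_mono simp: mult_nonpos_nonneg\<close>)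
  have "measure N {w \<in> space N. U w \<le> x} \<le> measure N {w \<in> space N. exp (b * x) \<le> exp (b * U w)}"
    using \<open>b \<le> 0\<close> by (intro finite_measure_mono) (auto intro: mult_left_mono_neg)
  also have "\<dots> \<le> (\<integral>w. exp (b * U w) \<partial>N) / exp (b * x)"
    by (rule integral_Markov_inequality_measure[OF int0, where A = "{}"]) auto
  also have "\<dots> \<le> exp (a * (exp (b * c) - 1) / c) / exp (b * x)"
    using size_bias_mgf_le[OF cpl nn int a bd \<open>0 < c\<close> \<open>b \<le> 0\<close>]
    by (intro divide_right_mono) auto
  finally show ?thesis by (simp add: exp_minus field_simps)
qed

lemma size_bias_lower_tail:
  assumes cpl: "is_coupling N U V \<mu> (size_bias_law \<mu>)"
    and nn: "AE w in N. 0 \<le> U w"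
    and int: "integrable N U"
    and a: "a = (\<integral>w. U w \<partial>N)" "0 < a"
    and bd: "AE w in N. V w \<le> U w + c"
    and "0 < c" "0 \<le> x" "x \<le> a"
  shows "measure N {w \<in> space N. U w \<le> x}
           \<le> (if x = 0 then 1 else (a / x) powr (x / c)) * exp ((x - a) / c)"
proof (cases "x = 0")
  case False
  with \<open>0 \<le> x\<close> have "0 < x" by simp
  define b where "b = ln (x / a) / c"
  have "b \<le> 0"
    unfolding b_def using \<open>0 < x\<close> a \<open>x \<le> a\<close> \<open>0 < c\<close> by (auto simp: divide_nonpos_pos)
  from size_bias_lower_chernoff[OF cpl nn int a bd \<open>0 < c\<close> this, of x] False show ?thesis
    unfolding poisson_chernoff_exponent[OF \<open>0 < a\<close> \<open>0 < c\<close> \<open>0 < x\<close> b_def] by simp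
next
  case True
  \<comment> \<open>The bound holds for every \<open>b \<le> 0\<close> and decreases to \<open>exp (- a / c)\<close> as \<open>b\<close> goes to \<open>-\<infinity>\<close>.\<close>
  have "filterlim (\<lambda>b. c * b) at_bot at_bot"
    by (rule filterlim_tendsto_pos_mult_at_bot[OF tendsto_const \<open>0 < c\<close> filterlim_ident])
  then have "((\<lambda>b. exp (b * c)) \<longlongrightarrow> 0) at_bot"
    using filterlim_compose[OF exp_at_bot] by (simp add: mult.commute)
  then have "((\<lambda>b. exp (a * (exp (b * c) - 1) / c)) \<longlongrightarrow> exp (a * (0 - 1) / c)) at_bot"
    using \<open>0 < c\<close> by (intro tendsto_intros) auto
  then have "measure N {w \<in> space N. U w \<le> 0} \<le> exp (a * (0 - 1) / c)"
  proof (rule tendsto_lowerbound)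
    show "\<forall>\<^sub>F b in at_bot. measure N {w \<in> space N. U w \<le> 0} \<le> exp (a * (exp (b * c) - 1) / c)"
      using eventually_le_at_bot[of 0]
      by eventually_elim
        (use size_bias_lower_chernoff[OF cpl nn int a bd \<open>0 < c\<close>, of _ 0] in simp)
  qed simp
  with True show ?thesis by simp
qed

text \<open>
  The bounds for the copy \<open>U\<close> of \<open>X\<close> carry over to \<open>X\<close>, since the mean and both tails depend on
  the law alone.
\<close>

theorem theorem1p3:
  fixes M :: "'a measure" and X :: "'a \<Rightarrow> real" and a c :: real
  assumes "prob_space M"
    and "X \<in> borel_measurable M"
    and "AE \<omega> in M. 0 \<le> X \<omega>"
    and "integrable M X"
    and "a = (\<integral>\<omega>. X \<omega> \<partial>M)"
    and "0 < a"
    and "0 < c"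
    and "\<exists>(N :: 'b measure) U V. bounded_size_bias_coupling c M X N U V"
  shows "(\<forall>x\<ge>a. measure M {\<omega> \<in> space M. x \<le> X \<omega>}
              \<le> (a / x) powr (x / c) * exp ((x - a) / c)) \<and>
         (\<forall>x. 0 \<le> x \<and> x \<le> a \<longrightarrow>
            measure M {\<omega> \<in> space M. X \<omega> \<le> x}
              \<le> (if x = 0 then 1 else (a / x) powr (x / c)) * exp ((x - a) / c))"
proof -
  obtain N :: "'b measure" and U V where
    cpl: "is_coupling N U V (distr M borel X) (size_bias_law (distr M borel X))"
    and bd: "AE w in N. V w \<le> U w + c"
    using assms(8) by (auto simp: bounded_size_bias_coupling_def)
  note [measurable] = assms(2)
  have [measurable]: "U \<in> borel_measurable N" and law: "distr N borel U = distr M borel X"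
    using cpl by (auto simp: is_coupling_def)
  have "AE y in distr N borel U. 0 \<le> y"
    unfolding law using assms(3) by (simp add: AE_distr_iff)
  then have nn: "AE w in N. 0 \<le> U w"
    by (simp add: AE_distr_iff)
  have "integrable (distr N borel U) (\<lambda>y. y)"
    unfolding law using assms(4) by (simp add: integrable_distr_eq)
  then have int: "integrable N U"
    by (simp add: integrable_distr_eq)
  have "(\<integral>w. U w \<partial>N) = (\<integral>y. y \<partial>distr N borel U)"
    by (simp add: integral_distr)
  also have "\<dots> = (\<integral>w. X w \<partial>M)"
    unfolding law by (simp add: integral_distr)
  finally have a: "a = (\<integral>w. U w \<partial>N)" using assms(5) by simp
  have prob: "measure M {w \<in> space M. X w \<in> A} = measure N {w \<in> space N. U w \<in> A}"
    if [measurable]: "A \<in> sets borel" for A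
  proof -
    have "measure (distr M borel X) A = measure (distr N borel U) A" by (simp add: law)
    then show ?thesis
      by (simp add: measure_distr vimage_def Int_def conj_commute)
  qed
  show ?thesis
    using size_bias_upper_tail[OF cpl nn int a assms(6) bd assms(7)]
      size_bias_lower_tail[OF cpl nn int a assms(6) bd assms(7)]
      prob[of "{x..}" for x] prob[of "{..x}" for x]
    by simp
qed

end
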